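(* Let $m$ be a positive integer and let $A=1$. Then every positive solution $\{(x_n,y_n,z_n)\}_{n\ge -m}$ of the system $$x_{n+1}=A+\frac{x_{n-m}}{z_n},\quad y_{n+1}=A+\frac{y_{n-m}}{z_n},\quad z_{n+1}=A+\frac{z_{n-m}}{y_n},\qquad n=0,1,2,\dots$$ is bounded and persists.
   Context: A positive solution of the system is a sequence $\{(x_n,y_n,z_n)\}_{n\ge -m}$ satisfying the recursion for all $n\ge 0$ whose initial values $x_{-i},y_{-i},z_{-i}$, $i=0,1,\dots,m$, are positive real numbers. A positive solution is bounded and persists if there exist constants $0<P\le Q<\infty$ (possibly depending on the solution) such that $P\le x_n,y_n,z_n\le Q$ for all $n\ge -m$. *)

theory Defs
  imports Complex_Main
begin

text \<open>Sequences indexed by the integers n \<open>\<ge>\<close> -m are total functions on \<open>int\<close>;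
  their values at indices below -m are unconstrained and irrelevant.\<close>

definition solves_system ::
  "real \<Rightarrow> nat \<Rightarrow> (int \<Rightarrow> real) \<Rightarrow> (int \<Rightarrow> real) \<Rightarrow> (int \<Rightarrow> real) \<Rightarrow> bool" where
  "solves_system A m x y z \<longleftrightarrow>
     (\<forall>n::int. n \<ge> 0 \<longrightarrow>
        x (n + 1) = A + x (n - int m) / z n \<and>
        y (n + 1) = A + y (n - int m) / z n \<and>
        z (n + 1) = A + z (n - int m) / y n)"

definition positive_solution ::
  "real \<Rightarrow> nat \<Rightarrow> (int \<Rightarrow> real) \<Rightarrow> (int \<Rightarrow> real) \<Rightarrow> (int \<Rightarrow> real) \<Rightarrow> bool" where
  "positive_solution A m x y z \<longleftrightarrow>
     solves_system A m x y z \<and>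
     (\<forall>i::nat. i \<le> m \<longrightarrow> x (- int i) > 0 \<and> y (- int i) > 0 \<and> z (- int i) > 0)"

definition bounded_and_persists ::
  "nat \<Rightarrow> (int \<Rightarrow> real) \<Rightarrow> (int \<Rightarrow> real) \<Rightarrow> (int \<Rightarrow> real) \<Rightarrow> bool" where
  "bounded_and_persists m x y z \<longleftrightarrow>
     (\<exists>P Q::real. 0 < P \<and> P \<le> Q \<and>
        (\<forall>n::int. n \<ge> - int m \<longrightarrow>
           P \<le> x n \<and> x n \<le> Q \<and> P \<le> y n \<and> y n \<le> Q \<and> P \<le> z n \<and> z n \<le> Q))"

end

theory Submission
  imports Defs
begin

text \<open>For \<open>A = 1\<close> all terms of positive index exceed 1.  If \<open>L, U > 1\<close> are conjugate,
  \<open>L + U = L * U\<close>, then \<open>1 + L / U = L\<close> and \<open>1 + U / L = U\<close>, so the box with sides \<open>[L, U]\<close> is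
  invariant under the recursion.  A large enough \<open>U\<close> makes the box contain the \<open>m + 1\<close> consecutive
  triples at indices \<open>1, \<dots>, m + 1\<close>, hence all later ones.\<close>

text \<open>The recursion reaches back \<open>m + 1\<close> steps, so one-step induction is too
  weak. The base \<open>b\<close> is an arbitrary integer because it is used with both
  \<open>- int m\<close> and \<open>1\<close>.\<close>

lemma int_ge_strong_induct [consumes 1, case_names step]:
  fixes b n :: int
  assumes "b \<le> n"
    and step: "\<And>n. b \<le> n \<Longrightarrow> (\<And>k. b \<le> k \<Longrightarrow> k < n \<Longrightarrow> P k) \<Longrightarrow> P n"
  shows "P n"
  using \<open>b \<le> n\<close>
proof (induction "nat (n - b)" arbitrary: n rule: less_induct)
  case less
  show ?case
    by (rule step[OF less.prems], rule less.hyps) auto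
qed

text \<open>On a finite set the minimum turns a strict pointwise bound into a uniform one with a gap
  above \<open>c\<close>.\<close>

lemma finite_bounds_gt:
  fixes S :: "real set"
  assumes "finite S" "\<And>s. s \<in> S \<Longrightarrow> c < s"
  obtains a b where "c < a" "a \<le> b" "\<And>s. s \<in> S \<Longrightarrow> a \<le> s \<and> s \<le> b"
proof (cases "S = {}")
  case True
  then show ?thesis
    using that[of "c + 1" "c + 1"] by simp
next
  case False
  with assms show ?thesis
    by (intro that[of "Min S" "Max S"]) auto
qed

lemma positive_solution_pos:
  assumes sol: "positive_solution A m x y z" and "0 \<le> A" and "- int m \<le> n"
  shows "0 < x n \<and> 0 < y n \<and> 0 < z n"
  using \<open>- int m \<le> n\<close>
proof (induction n rule: int_ge_strong_induct)
  case (step n)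
  show ?case
  proof (cases "n \<le> 0")
    case True
    then have "nat (- n) \<le> m" "n = - int (nat (- n))"
      using \<open>- int m \<le> n\<close> by auto
    then show ?thesis
      using sol unfolding positive_solution_def by metis
  next
    case False
    define k where "k = n - 1"
    have k: "0 \<le> k" "n = k + 1"
      using False by (auto simp: k_def)
    have "0 < x k \<and> 0 < y k \<and> 0 < z k"
      "0 < x (k - int m) \<and> 0 < y (k - int m) \<and> 0 < z (k - int m)"
      using k by (auto intro!: step.IH)
    then show ?thesis
      using sol k \<open>0 \<le> A\<close>
      by (auto simp: positive_solution_def solves_system_def intro!: add_nonneg_pos)
  qed
qed

text \<open>Each such term is \<open>A\<close> plus a quotient of positive terms. The range starts
  at 1 because the term at index 0 is an initial value.\<close>

lemma positive_solution_gt: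
  assumes sol: "positive_solution A m x y z" and "0 \<le> A" and "1 \<le> n"
  shows "A < x n \<and> A < y n \<and> A < z n"
proof -
  define k where "k = n - 1"
  have k: "0 \<le> k" "n = k + 1"
    using \<open>1 \<le> n\<close> by (auto simp: k_def)
  have "0 < x k \<and> 0 < y k \<and> 0 < z k"
    "0 < x (k - int m) \<and> 0 < y (k - int m) \<and> 0 < z (k - int m)"
    using positive_solution_pos[OF sol \<open>0 \<le> A\<close>] k by auto
  then show ?thesis
    using sol k by (auto simp: positive_solution_def solves_system_def)
qed

lemma conjugate_interval_invariant:
  fixes L U u v :: real
  assumes "1 < L" "1 < U" "L + U = L * U" "u \<in> {L..U}" "v \<in> {L..U}"
  shows "1 + u / v \<in> {L..U}"
proof -
  have "L / U \<le> u / v" "u / v \<le> U / L"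
    using assms by (auto intro!: frac_le)
  moreover have "1 + L / U = L" "1 + U / L = U"
    using assms by (auto simp: field_simps)
  ultimately show ?thesis
    by auto
qed

lemma solves_system_in_conjugate_interval:
  assumes sys: "solves_system 1 m x y z"
    and conj: "1 < L" "1 < U" "L + U = L * U"
    and init: "\<And>k. k \<in> {1..int m + 1} \<Longrightarrow> {x k, y k, z k} \<subseteq> {L..U}"
    and "1 \<le> n"
  shows "{x n, y n, z n} \<subseteq> {L..U}"
  using \<open>1 \<le> n\<close>
proof (induction n rule: int_ge_strong_induct)
  case (step n)
  show ?case
  proof (cases "n \<le> int m + 1")
    case True
    then show ?thesis
      using init \<open>1 \<le> n\<close> by simp
  next
    case False
    \<comment> \<open>Now \<open>n\<close> is at least \<open>m + 2\<close>, so both indices that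
      the recursion reads, \<open>k\<close> and \<open>k - int m\<close>, are at least 1 and below
      \<open>n\<close>.\<close>
    define k where "k = n - 1"
    have k: "0 \<le> k" "n = k + 1"
      using False by (auto simp: k_def)
    have "{x k, y k, z k} \<subseteq> {L..U}" "{x (k - int m), y (k - int m), z (k - int m)} \<subseteq> {L..U}"
      by (rule step.IH; use False in \<open>simp add: k_def\<close>)+
    then show ?thesis
      using sys k conjugate_interval_invariant[OF conj]
      \<comment> \<open>Interval membership stays folded so that the invariance lemma can
        match.\<close>
      by (simp add: solves_system_def del: atLeastAtMost_iff)
  qed
qed

theorem theorem3p3:
  fixes m :: nat and A :: real and x y z :: "int \<Rightarrow> real"
  assumes "m \<ge> 1" and "A = 1"
    and "positive_solution A m x y z"
  shows "bounded_and_persists m x y z"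
proof -
  have sol: "positive_solution 1 m x y z"
    using assms by simp
  \<comment> \<open>Pooling the values of all three sequences lets a single pair of bounds serve
    them all.\<close>
  define W where "W = (\<lambda>I::int set. x ` I \<union> y ` I \<union> z ` I)"
  have W_fin: "finite (W {a..b})" for a b
    by (simp add: W_def)
  have "1 < s" if "s \<in> W {1..int m + 1}" for s
    using that positive_solution_gt[OF sol] by (auto simp: W_def)
  then obtain a b where ab: "1 < a" "a \<le> b"
    and W1: "\<And>s. s \<in> W {1..int m + 1} \<Longrightarrow> a \<le> s \<and> s \<le> b"
    using finite_bounds_gt[OF W_fin, of 1 "int m + 1" 1] by blast
  have "0 < s" if "s \<in> W {- int m..0}" for s
    using that positive_solution_pos[OF sol] by (auto simp: W_def)
  then obtain c d where cd: "0 < c" "c \<le> d"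
    and W0: "\<And>s. s \<in> W {- int m..0} \<Longrightarrow> c \<le> s \<and> s \<le> d"
    using finite_bounds_gt[OF W_fin, of "- int m" 0 0] by blast
  \<comment> \<open>The conjugate of \<open>t\<close> is \<open>t / (t - 1)\<close>, which decreases
    for \<open>t > 1\<close>. Taking \<open>U\<close> at least the conjugate of \<open>a\<close>
    therefore forces its own conjugate \<open>L\<close> down to at most \<open>a\<close>.\<close>
  define U where "U = max b (a / (a - 1))"
  define L where "L = U / (U - 1)"
  have "1 < U" "b \<le> U"
    using ab by (auto simp: U_def)
  moreover from this have "1 < L" "L + U = L * U"
    by (auto simp: L_def field_simps)
  moreover have "L \<le> a"
  proof -
    have "a / (a - 1) \<le> U"
      by (simp add: U_def)
    then show ?thesis
      using ab \<open>1 < U\<close> by (simp add: L_def field_simps)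
  qed
  ultimately have box: "1 < L" "1 < U" "L + U = L * U" and "{a..b} \<subseteq> {L..U}"
    by auto
  have "{x k, y k, z k} \<subseteq> {a..b}" if "k \<in> {1..int m + 1}" for k
    using that W1 by (auto simp: W_def)
  with \<open>{a..b} \<subseteq> {L..U}\<close>
  have init: "{x k, y k, z k} \<subseteq> {L..U}" if "k \<in> {1..int m + 1}" for k
    using that by blast
  have sys: "solves_system 1 m x y z"
    using sol by (simp add: positive_solution_def)
  have late: "{x n, y n, z n} \<subseteq> {L..U}" if "1 \<le> n" for n
    by (rule solves_system_in_conjugate_interval[OF sys box init that])
  have early: "{x n, y n, z n} \<subseteq> {c..d}" if "- int m \<le> n" "n \<le> 0" for n
    using that W0 by (auto simp: W_def)
  \<comment> \<open>Initial values may lie outside the invariant box, even below 1, so their own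
    bounds \<open>c\<close> and \<open>d\<close> are merged in.\<close>
  have "{x n, y n, z n} \<subseteq> {min c L..max d U}" if "- int m \<le> n" for n
    using late[of n] early[of n] that by (cases "n \<le> 0") auto
  moreover have "0 < min c L" "min c L \<le> max d U"
    using cd \<open>1 < L\<close> by auto
  ultimately show ?thesis
    unfolding bounded_and_persists_def
    by (intro exI[of _ "min c L"] exI[of _ "max d U"]) simp
qed

end
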